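(* Let $M$ be a von Neumann algebra and let $a,b\in M$ with $0\le a,b\le 1$. Then the following are equivalent: (a) $a$ is absolutely compatible with $b$; (b) there exists a projection $p_1\in M$ such that, writing $p_2=1-p_1$, $a_{ij}=p_i a p_j$ and $b_{ij}=p_i b p_j$ ($i,j\in\{1,2\}$), so that $a=\begin{pmatrix} a_{11} & a_{12}\\ a_{12}^* & a_{22}\end{pmatrix}$ and $b=\begin{pmatrix} b_{11} & b_{12}\\ b_{12}^* & b_{22}\end{pmatrix}$ with respect to $\{p_1,p_2\}$, the following hold: (b.1) $p_1$ is the range projection of $a\circ b$; (b.2) $a_{12}+b_{12}=0$; (b.3) $|a_{12}^*|^2=(p_1-a_{11})(p_1-b_{11})$ (and hence $a_{11}b_{11}=b_{11}a_{11}$); (b.4) $|a_{12}|^2=a_{22}b_{22}=b_{22}a_{22}$; (b.5) $a_{12}=a_{11}a_{12}+a_{12}a_{22}=b_{11}a_{12}+a_{12}b_{22}$.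
   Context: For $x$ in a C$^*$-algebra, $|x|=(x^*x)^{1/2}$. For elements $0\le a,b\le 1$ of a unital C$^*$-algebra, $a$ is called absolutely compatible with $b$ if $|a-b|+|1-a-b|=1$. The Jordan product is $a\circ b=\frac12(ab+ba)$. The range projection $r(x)$ of a positive element $x$ of a von Neumann algebra is the smallest projection $p$ with $px=x$. *)

theory Defs
  imports "HOL-Analysis.Analysis"
begin

text \<open>
  Complex Hilbert spaces are modelled as real Hilbert spaces (class real_inner + complete_space)
  together with a complex structure J (multiplication by the imaginary unit):
  J is a real-linear isometry with J o J = -1. The complex inner product is then
  <x,y>_C = inner x y + i * inner x (J y) (up to convention); its real part is inner.
  Bounded complex-linear operators are the bounded real-linear operators commuting with J.
  The Hilbert-space adjoint w.r.t. the complex inner product coincides with the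
  adjoint w.r.t. the real inner product.
\<close>

type_synonym 'h op = "'h \<Rightarrow>\<^sub>L 'h"

definition complex_structure :: "'h::{real_inner,complete_space} op \<Rightarrow> bool" where
  "complex_structure J \<longleftrightarrow> J o\<^sub>L J = - id_blinfun \<and> (\<forall>x y. inner (J x) (J y) = inner x y)"

definition bops :: "'h::{real_inner,complete_space} op \<Rightarrow> 'h op set" where
  "bops J = {T. T o\<^sub>L J = J o\<^sub>L T}"

definition adj :: "'h::{real_inner,complete_space} op \<Rightarrow> 'h op" where
  "adj T = (THE S::'h op. \<forall>x y. inner (T x) y = inner x (S y))"

definition commutant :: "'h::{real_inner,complete_space} op \<Rightarrow> 'h op set \<Rightarrow> 'h op set" where
  "commutant J S = {T \<in> bops J. \<forall>A\<in>S. T o\<^sub>L A = A o\<^sub>L T}"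

definition von_neumann_algebra :: "'h::{real_inner,complete_space} op \<Rightarrow> 'h op set \<Rightarrow> bool" where
  "von_neumann_algebra J M \<longleftrightarrow> complex_structure J \<and> M \<subseteq> bops J \<and>
     (\<forall>T\<in>M. adj T \<in> M) \<and> commutant J (commutant J M) = M"

text \<open>Positive operator: self-adjoint with nonnegative quadratic form
  (equivalently, complex quadratic form <Tx,x>_C is real and nonnegative).\<close>
definition positive :: "'h::{real_inner,complete_space} op \<Rightarrow> bool" where
  "positive T \<longleftrightarrow> adj T = T \<and> (\<forall>x. 0 \<le> inner (T x) x)"

definition op_abs :: "'h::{real_inner,complete_space} op \<Rightarrow> 'h op" where
  "op_abs x = (THE r. positive r \<and> r o\<^sub>L r = adj x o\<^sub>L x)"

definition is_projection :: "'h::{real_inner,complete_space} op \<Rightarrow> bool" where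
  "is_projection p \<longleftrightarrow> p o\<^sub>L p = p \<and> adj p = p"

text \<open>p is the range projection of x in M: the smallest projection p in M with p x = x
  (projections ordered by q \<ge> p iff q p = p).\<close>
definition is_range_projection ::
  "'h::{real_inner,complete_space} op set \<Rightarrow> 'h op \<Rightarrow> 'h op \<Rightarrow> bool" where
  "is_range_projection M x p \<longleftrightarrow> p \<in> M \<and> is_projection p \<and> p o\<^sub>L x = x \<and>
     (\<forall>q\<in>M. is_projection q \<and> q o\<^sub>L x = x \<longrightarrow> q o\<^sub>L p = p)"

definition jordan :: "'h::{real_inner,complete_space} op \<Rightarrow> 'h op \<Rightarrow> 'h op" where
  "jordan a b = (1/2::real) *\<^sub>R ((a o\<^sub>L b) + (b o\<^sub>L a))"

definition unit_interval_op :: "'h::{real_inner,complete_space} op \<Rightarrow> bool" where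
  "unit_interval_op a \<longleftrightarrow> positive a \<and> positive (id_blinfun - a)"

definition absolutely_compatible :: "'h::{real_inner,complete_space} op \<Rightarrow> 'h op \<Rightarrow> bool" where
  "absolutely_compatible a b \<longleftrightarrow>
     op_abs (a - b) + op_abs (id_blinfun - a - b) = id_blinfun"

end

theory Submission
  imports Defs
begin

text \<open>
  Write \<open>a = k + h\<close>, \<open>b = k - h\<close> and \<open>v = |a - b| / 2\<close>. Absolute compatibility says that
  \<open>1 - 2 v = |1 - 2 k|\<close>; squaring gives \<open>k\<^sup>2 = k - v + v\<^sup>2\<close>, and \<open>v\<close> commutes with \<open>h\<close> and \<open>k\<close>.
  Hence \<open>a \<circ> b = k\<^sup>2 - h\<^sup>2 = k - v\<close>, which \<open>1 - k - v\<close> annihilates: its range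
  projection \<open>p\<close> satisfies \<open>k p = (1 - v) p\<close> and \<open>k (1 - p) = v (1 - p)\<close>.
  With \<open>h\<^sup>2 = v\<^sup>2\<close> all block identities follow by expanding words in \<open>p\<close>, \<open>v\<close>, \<open>h\<close>.

  Conversely, put \<open>u = (p - a\<^sub>1\<^sub>1) + (p - b\<^sub>1\<^sub>1) + a\<^sub>2\<^sub>2 + b\<^sub>2\<^sub>2\<close>. The block identities give
  \<open>u\<^sup>2 = (a - b)\<^sup>2\<close> and \<open>(1 - u)\<^sup>2 = (1 - a - b)\<^sup>2\<close>, and \<open>a\<^sup>2 \<le> a\<close>, \<open>b\<^sup>2 \<le> b\<close> give
  \<open>(1 - u)\<^sup>2 \<le> 1 - u\<close>, so that \<open>u\<close> and \<open>1 - u\<close> are the two absolute values.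
\<close>

text \<open>The library's infix for composition binds weaker than \<open>+\<close>.\<close>

notation blinfun_compose (infixl "\<cdot>" 70)

section \<open>Riesz representation and adjoints\<close>

text \<open>The representing vector minimises \<open>inner x x - 2 * f x\<close> over
  \<open>S\<close>: the parallelogram law makes a minimising sequence Cauchy. Allowing any closed
  \<open>S\<close> serves adjoints (\<open>S = UNIV\<close>) and orthogonal projections at
  once.\<close>

lemma riesz_closed_subspace:
  fixes f :: "'h::{real_inner,complete_space} \<Rightarrow> real"
  assumes S: "subspace S" "closed S" and f: "bounded_linear f"
  obtains z where "z \<in> S" "\<And>x. x \<in> S \<Longrightarrow> f x = inner x z"
proof -
  interpret f: bounded_linear f by (fact f)
  define Q where "Q x = inner x x - 2 * f x" for x
  obtain K where K: "\<And>x. norm (f x) \<le> norm x * K" using f.bounded by blast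
  \<comment> \<open>Completing the square in \<open>norm x\<close> bounds \<open>Q\<close>
    below.\<close>
  have low: "- (K\<^sup>2) \<le> Q x" for x
  proof -
    have "f x \<le> norm x * K" using K[of x] by simp
    moreover have "0 \<le> (norm x - K)\<^sup>2" by simp
    ultimately show ?thesis
      by (simp add: Q_def power2_diff power2_norm_eq_inner)
  qed
  have bdd: "bdd_below (Q ` S)" using low by (intro bdd_belowI2)
  define m where "m = Inf (Q ` S)"
  have m: "m \<le> Q x" if "x \<in> S" for x
    unfolding m_def using bdd that by (intro cInf_lower) auto
  have ne: "Q ` S \<noteq> {}" using subspace_0[OF S(1)] by auto
  have "\<exists>x\<in>S. Q x < m + 1 / real (Suc n)" for n
    using cInf_less_iff[OF ne bdd, of "m + 1 / real (Suc n)"] by (auto simp: m_def)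
  then obtain X where X: "\<And>n. X n \<in> S" "\<And>n. Q (X n) < m + 1 / real (Suc n)"
    by metis
  \<comment> \<open>Parallelogram law: the left side equals \<open>2 * (Q x + Q y)\<close> minus
    four times the value of \<open>Q\<close> at the midpoint, and the midpoint lies in
    \<open>S\<close>.\<close>
  have para: "(norm (x - y))\<^sup>2 \<le> 2 * (Q x - m) + 2 * (Q y - m)" if "x \<in> S" "y \<in> S" for x y
  proof -
    have "(1/2) *\<^sub>R (x + y) \<in> S" using that S(1) by (intro subspace_mul subspace_add)
    from m[OF this] show ?thesis
      unfolding Q_def power2_norm_eq_inner
      by (simp add: f.add f.scaleR inner_diff_left inner_diff_right inner_add_left inner_add_right
          inner_commute[of y x] algebra_simps)
  qed
  have "Cauchy X"
  proof (rule CauchyI)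
    fix e :: real assume e: "0 < e"
    obtain N :: nat where N: "4 / e\<^sup>2 < real N" using reals_Archimedean2 by blast
    have "norm (X i - X j) < e" if "N \<le> i" "N \<le> j" for i j
    proof -
      have *: "1 / real (Suc k) < e\<^sup>2 / 4" if "N \<le> k" for k
      proof -
        have "4 / e\<^sup>2 < real (Suc k)" using N that by simp
        then show ?thesis using e by (simp add: field_simps)
      qed
      have "(norm (X i - X j))\<^sup>2 \<le> 2 * (Q (X i) - m) + 2 * (Q (X j) - m)"
        using para X(1) by blast
      also have "\<dots> < e\<^sup>2"
      proof -
        have "Q (X k) - m < e\<^sup>2 / 4" if "N \<le> k" for k
          using X(2)[of k] *[OF that] by (simp del: of_nat_Suc)
        from this[OF that(1)] this[OF that(2)] show ?thesis by simp
      qed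
      finally show ?thesis using e by (simp add: power_less_imp_less_base)
    qed
    then show "\<exists>M. \<forall>i\<ge>M. \<forall>j\<ge>M. norm (X i - X j) < e" by blast
  qed
  then obtain z where z: "X \<longlonglongrightarrow> z" using Cauchy_convergent convergent_def by blast
  have zS: "z \<in> S" using closed_sequentially[OF S(2) _ z] X(1) by blast
  have "(\<lambda>n. Q (X n)) \<longlonglongrightarrow> Q z"
    unfolding Q_def by (intro tendsto_intros f.tendsto z)
  moreover have "(\<lambda>n. m + 1 / real (Suc n)) \<longlonglongrightarrow> m + 0"
    by (intro tendsto_add tendsto_const LIMSEQ_Suc lim_1_over_n)
  ultimately have Qz: "Q z \<le> m"
    using X(2) by (intro LIMSEQ_le[of "\<lambda>n. Q (X n)" "Q z" "\<lambda>n. m + 1 / real (Suc n)" m])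
      (auto intro: less_imp_le)
  have "f h = inner h z" if h: "h \<in> S" for h
  proof (rule ccontr)
    assume ne: "f h \<noteq> inner h z"
    define d where "d = f h - inner h z"
    define k where "k = inner h h"
    \<comment> \<open>Minimality of \<open>z\<close> along the line
      \<open>z + t *\<^sub>R h\<close>.\<close>
    have *: "0 \<le> t * t * k - 2 * t * d" for t
    proof -
      have "z + t *\<^sub>R h \<in> S" using zS h S(1) by (intro subspace_mul subspace_add)
      from m[OF this] Qz have "Q z \<le> Q (z + t *\<^sub>R h)" by simp
      then show ?thesis
        unfolding Q_def d_def k_def
        by (simp add: f.add f.scaleR inner_add_left inner_add_right inner_commute[of z h]
            algebra_simps)
    qed
    have d: "d \<noteq> 0" using ne by (simp add: d_def)
    have k: "0 \<le> k" by (simp add: k_def)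
    \<comment> \<open>The step \<open>t = d / (k + 1)\<close> is short enough to decrease
      \<open>Q\<close>; the \<open>+ 1\<close> keeps the denominator positive even for
      \<open>h = 0\<close>.\<close>
    have "0 \<le> (d / (k + 1)) * (d / (k + 1)) * k - 2 * (d / (k + 1)) * d" by (rule *)
    also have "\<dots> = - (d * d) * (k + 2) / ((k + 1) * (k + 1))"
      using k by (simp add: divide_simps) (simp add: algebra_simps)
    also have "\<dots> < 0"
      using d k by (intro divide_neg_pos mult_neg_pos mult_pos_pos)
        (auto simp: zero_less_mult_iff)
    finally show False by simp
  qed
  with zS show ?thesis by (rule that)
qed

text \<open>A vector is determined by its inner products, so the adjoint relation alone forces
  linearity. It is applied to adjoints and to orthogonal projections.\<close>

lemma formal_adjoint_bounded_linear:
  fixes S :: "'h::real_inner \<Rightarrow> 'h"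
  assumes TS: "\<And>x y. inner (T x) y = inner x (S y)" and S: "\<And>y. norm (S y) \<le> norm y * K"
  shows "bounded_linear S"
proof (rule bounded_linear_intro[OF _ _ S])
  show "S (x + y) = S x + S y" for x y
    by (simp add: vector_eq_rdot[symmetric] inner_add_left inner_commute[of "S _"]
        inner_add_right flip: TS)
  show "S (r *\<^sub>R x) = r *\<^sub>R S x" for r x
    by (simp add: vector_eq_rdot[symmetric] inner_commute[of "S _"] flip: TS)
qed

lemma adjoint_exists:
  fixes T :: "'h::{real_inner,complete_space} op"
  shows "\<exists>S::'h op. \<forall>x y. inner (T x) y = inner x (S y)"
proof -
  have "\<exists>z. \<forall>x. inner (T x) y = inner x z" for y
  proof -
    have "bounded_linear (\<lambda>x. inner (T x) y)"
      by (rule bounded_linear_inner_left_comp[OF blinfun.bounded_linear_right])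
    then obtain z where "\<And>x. x \<in> UNIV \<Longrightarrow> inner (T x) y = inner x z"
      by (rule riesz_closed_subspace[OF subspace_UNIV closed_UNIV]) (rule that)
    then show ?thesis by blast
  qed
  then obtain S where S: "\<And>x y. inner (T x) y = inner x (S y)" by metis
  \<comment> \<open>The adjoint relation is tested at \<open>x = S y\<close>.\<close>
  have "norm (S y) \<le> norm y * norm T" for y
  proof (cases "S y = 0")
    case False
    have "norm (S y) * norm (S y) = inner (T (S y)) y"
      by (simp add: S norm_eq_sqrt_inner)
    also have "\<dots> \<le> norm (T (S y)) * norm y" by (rule norm_cauchy_schwarz)
    also have "\<dots> \<le> norm T * norm (S y) * norm y"
      by (intro mult_right_mono norm_blinfun) auto
    finally show ?thesis using False by (simp add: ac_simps)
  qed simp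
  then have "bounded_linear S" by (rule formal_adjoint_bounded_linear[OF S])
  then show ?thesis
    using S by (intro exI[of _ "Blinfun S"]) (simp add: bounded_linear_Blinfun_apply)
qed

lemma adj_eqI:
  fixes S T :: "'h::{real_inner,complete_space} op"
  assumes "\<And>x y. inner (T x) y = inner x (S y)"
  shows "adj T = S"
  unfolding adj_def
proof (rule the_equality)
  fix S' :: "'h op"
  assume S': "\<forall>x y. inner (T x) y = inner x (S' y)"
  show "S' = S"
  proof (rule blinfun_eqI)
    fix y
    have "inner x (S' y) = inner x (S y)" for x using S' assms by metis
    then show "S' y = S y" by (metis vector_eq_ldot)
  qed
qed (use assms in blast)

lemma inner_adj_right: "inner x (adj T y) = inner (T x) y"
proof -
  obtain S where S: "\<And>x y. inner (T x) y = inner x (blinfun_apply S y)"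
    using adjoint_exists[of T] by blast
  from adj_eqI[OF this] S show ?thesis by simp
qed

lemma inner_adj_left: "inner (adj T x) y = inner x (T y)"
  by (metis inner_adj_right inner_commute)

lemma adj_adj [simp]: "adj (adj T) = T"
  by (rule adj_eqI) (rule inner_adj_left)

lemma adj_compose [simp]: "adj (S \<cdot> T) = adj T \<cdot> adj S"
  by (rule adj_eqI) (simp add: inner_adj_right)

lemma adj_add [simp]: "adj (S + T) = adj S + adj T"
  by (rule adj_eqI) (simp add: inner_adj_right blinfun.bilinear_simps inner_add_left inner_add_right)

lemma adj_diff [simp]: "adj (S - T) = adj S - adj T"
  by (rule adj_eqI) (simp add: inner_adj_right blinfun.bilinear_simps inner_diff_left inner_diff_right)

lemma adj_scaleR [simp]: "adj (r *\<^sub>R T) = r *\<^sub>R adj T"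
  by (rule adj_eqI) (simp add: inner_adj_right blinfun.bilinear_simps)

lemma adj_id [simp]: "adj id_blinfun = id_blinfun"
  by (rule adj_eqI) simp

lemma adj_zero [simp]: "adj 0 = 0"
  by (rule adj_eqI) simp

lemma self_adjoint_eqI:
  assumes "adj T = T" "\<And>x. inner (T x) x = 0"
  shows "T = 0"
proof (rule blinfun_eqI)
  fix x
  \<comment> \<open>Polarisation: at \<open>x + T x\<close> the two mixed terms of the form add up
    to \<open>2 * inner (T x) (T x)\<close>.\<close>
  have "inner (T (x + T x)) (x + T x) = 0" by (rule assms)
  moreover have "inner (T (T x)) x = inner (T x) (T x)"
    by (metis assms(1) inner_adj_right)
  ultimately have "2 * inner (T x) (T x) = 0"
    using assms(2)[of x] assms(2)[of "T x"]
    by (simp add: blinfun.bilinear_simps inner_add_left inner_add_right)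
  then show "T x = blinfun_apply 0 x" by simp
qed

section \<open>The ring of bounded operators\<close>

lemma blinfun_compose_id [simp]: "id_blinfun \<cdot> T = T" "T \<cdot> id_blinfun = T"
  by (auto intro: blinfun_eqI)

lemma blinfun_compose_assoc: "(A \<cdot> B) \<cdot> C = A \<cdot> (B \<cdot> C)"
  by (auto intro: blinfun_eqI)

lemmas compose_bilinear =
  bounded_bilinear.add_left[OF bounded_bilinear_blinfun_compose]
  bounded_bilinear.add_right[OF bounded_bilinear_blinfun_compose]
  bounded_bilinear.diff_left[OF bounded_bilinear_blinfun_compose]
  bounded_bilinear.diff_right[OF bounded_bilinear_blinfun_compose]
  bounded_bilinear.minus_left[OF bounded_bilinear_blinfun_compose]
  bounded_bilinear.minus_right[OF bounded_bilinear_blinfun_compose]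
  bounded_bilinear.scaleR_left[OF bounded_bilinear_blinfun_compose]
  bounded_bilinear.scaleR_right[OF bounded_bilinear_blinfun_compose]

text \<open>Expands a noncommutative polynomial into a combination of right-nested words.\<close>

lemmas op_ring = compose_bilinear blinfun_compose_assoc

lemma self_adjoint_square_zero:
  assumes "adj T = T" "T \<cdot> T = 0"
  shows "T = 0"
proof (rule blinfun_eqI)
  fix x
  have "inner (T x) (T x) = inner ((T \<cdot> T) x) x"
    using inner_adj_right[of "T x" T x] by (simp add: assms(1))
  then show "T x = blinfun_apply 0 x" by (simp add: assms(2))
qed

text \<open>In right-nested words a relation for \<open>A \<cdot> B\<close> matches only the last
  two letters; this form applies it further inside.\<close>

lemma compose_eq_rewrite:
  assumes "A \<cdot> B = C"
  shows "A \<cdot> (B \<cdot> D) = C \<cdot> D"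
  by (simp add: assms flip: blinfun_compose_assoc)

section \<open>Positive operators and square roots\<close>

lemma positive_adj: "positive T \<Longrightarrow> adj T = T"
  by (simp add: positive_def)

lemma positive_nonneg: "positive T \<Longrightarrow> 0 \<le> inner (T x) x"
  by (simp add: positive_def)

lemma positive_add: "positive S \<Longrightarrow> positive T \<Longrightarrow> positive (S + T)"
  by (simp add: positive_def blinfun.bilinear_simps inner_add_left)

lemma positive_scaleR: "positive T \<Longrightarrow> 0 \<le> r \<Longrightarrow> positive (r *\<^sub>R T)"
  by (simp add: positive_def blinfun.bilinear_simps)

lemma positive_conj: "positive T \<Longrightarrow> positive (adj S \<cdot> T \<cdot> S)"
  by (simp add: positive_def blinfun_compose_assoc inner_adj_left)

lemma positive_adj_compose: "positive (adj S \<cdot> S)"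
  by (simp add: positive_def inner_adj_left)

lemma positive_Cauchy_Schwarz:
  assumes T: "positive T"
  shows "(inner (T x) y)\<^sup>2 \<le> inner (T x) x * inner (T y) y"
proof -
  have sym: "inner (T y) x = inner (T x) y"
    by (metis inner_adj_right inner_commute positive_adj[OF T])
  define A B C where "A = inner (T x) x" and "B = inner (T x) y" and "C = inner (T y) y"
  have quad: "0 \<le> s * s * A + 2 * s * t * B + t * t * C" for s t
    using positive_nonneg[OF T, of "s *\<^sub>R x + t *\<^sub>R y"]
    by (simp add: blinfun.bilinear_simps inner_add_left inner_add_right sym A_def B_def C_def
        algebra_simps)
  have AC: "0 \<le> A" "0 \<le> C" using T by (simp_all add: A_def C_def positive_nonneg)
  show ?thesis
  proof (cases "C = 0")
    case True
    have "B = 0"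
    proof (rule ccontr)
      assume B: "B \<noteq> 0"
      \<comment> \<open>For \<open>C = 0\<close> and \<open>s = 1\<close> the form is affine in
        \<open>t\<close>; this \<open>t\<close> gives it the value -1.\<close>
      have "0 \<le> A + 2 * (- (A + 1) / (2 * B)) * B" using quad[of 1 "- (A + 1) / (2 * B)"] True by simp
      then show False using B by (simp add: field_simps)
    qed
    then show ?thesis using AC by (simp flip: A_def B_def C_def)
  next
    case False
    then have C: "0 < C" using AC by simp
    \<comment> \<open>The point \<open>s = C\<close>, \<open>t = - B\<close> exposes the
      discriminant.\<close>
    have "0 \<le> C * (A * C - B * B)" using quad[of C "- B"] by (simp add: algebra_simps)
    then have "0 \<le> A * C - B * B" using C by (simp add: zero_le_mult_iff)
    then show ?thesis by (simp add: power2_eq_square flip: A_def B_def C_def)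
  qed
qed

section \<open>Operators between 0 and 1\<close>

lemma unit_interval_square_le:
  assumes "unit_interval_op a"
  shows "(norm (a x))\<^sup>2 \<le> inner (a x) x"
proof -
  have a: "positive a" and a': "positive (id_blinfun - a)"
    using assms by (auto simp: unit_interval_op_def)
  define n where "n = inner (a x) (a x)"
  \<comment> \<open>Cauchy-Schwarz for the form of \<open>a\<close> at \<open>x\<close> and
    \<open>a x\<close>; then \<open>a \<le> 1\<close> at \<open>a x\<close> bounds the last factor
    by \<open>n\<close>, which cancels.\<close>
  have "n\<^sup>2 \<le> inner (a x) x * inner (a (a x)) (a x)"
    unfolding n_def by (rule positive_Cauchy_Schwarz[OF a])
  also have "\<dots> \<le> inner (a x) x * n"
    using positive_nonneg[OF a', of "a x"] positive_nonneg[OF a, of x]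
    by (intro mult_left_mono) (auto simp: n_def blinfun.bilinear_simps inner_diff_left)
  finally have "n * n \<le> inner (a x) x * n" by (simp add: power2_eq_square)
  moreover have "0 \<le> n" by (simp add: n_def)
  ultimately have "n \<le> inner (a x) x"
    using positive_nonneg[OF a, of x] by (cases "n = 0") auto
  then show ?thesis by (simp add: n_def power2_norm_eq_inner)
qed

lemma unit_interval_norm_le_1:
  assumes "unit_interval_op a"
  shows "norm a \<le> 1"
proof (rule norm_blinfun_bound)
  fix x
  have "norm (a x) * norm (a x) \<le> norm (a x) * norm x"
    using unit_interval_square_le[OF assms, of x] norm_cauchy_schwarz[of "a x" x]
    by (simp add: power2_eq_square)
  then show "norm (a x) \<le> 1 * norm x"
    by (cases "a x = 0") auto
qed simp

lemma unit_interval_diff_square_positive: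
  assumes "unit_interval_op a"
  shows "positive (a - a \<cdot> a)"
proof -
  have a: "adj a = a" using assms by (simp add: unit_interval_op_def positive_adj)
  have "inner (a (a x)) x = (norm (a x))\<^sup>2" for x
    using inner_adj_right[of "a x" a x] by (simp add: a power2_norm_eq_inner)
  then show ?thesis using unit_interval_square_le[OF assms] a
    by (simp add: positive_def blinfun.bilinear_simps inner_diff_left)
qed

lemma positive_diff_norm:
  assumes "adj T = T" "norm T \<le> 1"
  shows "positive (id_blinfun - T)"
proof -
  have "inner (T x) x \<le> inner x x" for x
  proof -
    have "inner (T x) x \<le> norm (T x) * norm x" by (rule norm_cauchy_schwarz)
    also have "\<dots> \<le> (norm T * norm x) * norm x" by (intro mult_right_mono norm_blinfun) auto
    also have "\<dots> \<le> (1 * norm x) * norm x" using assms(2) by (intro mult_right_mono) auto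
    also have "\<dots> = inner x x" by (simp add: norm_eq_sqrt_inner)
    finally show ?thesis .
  qed
  then show ?thesis
    using assms(1) by (simp add: positive_def blinfun.bilinear_simps inner_diff_left)
qed

section \<open>Square roots by a norm-convergent iteration\<close>

lemma bounded_linear_adj: "bounded_linear (adj :: 'h::{real_inner,complete_space} op \<Rightarrow> 'h op)"
proof (rule bounded_linear_intro[where K = 1])
  fix T :: "'h op"
  show "norm (adj T) \<le> norm T * 1"
  proof (rule norm_blinfun_bound)
    fix y
    show "norm (adj T y) \<le> norm T * 1 * norm y"
    proof (cases "adj T y = 0")
      case False
      have "norm (adj T y) * norm (adj T y) = inner (T (adj T y)) y"
        using power2_norm_eq_inner[of "adj T y"] by (simp add: power2_eq_square inner_adj_right)
      also have "\<dots> \<le> norm (T (adj T y)) * norm y" by (rule norm_cauchy_schwarz)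
      also have "\<dots> \<le> norm T * norm (adj T y) * norm y"
        by (intro mult_right_mono norm_blinfun) auto
      finally show ?thesis using False by (simp add: ac_simps)
    qed simp
  qed simp
qed simp_all

text \<open>The library proves this for codomains of class \<open>banach\<close>, of which
  \<open>{real_normed_vector,complete_space}\<close> is not a subsort.\<close>

lemma blinfun_Cauchy_convergent:
  fixes X :: "nat \<Rightarrow> 'a::real_normed_vector \<Rightarrow>\<^sub>L 'b::{real_normed_vector,complete_space}"
  assumes X: "Cauchy X"
  shows "convergent X"
proof -
  have "Cauchy (\<lambda>n. X n x)" for x
    by (rule bounded_linear.Cauchy[OF blinfun.bounded_linear_left X])
  then have "\<exists>l. (\<lambda>n. X n x) \<longlonglongrightarrow> l" for x
    using Cauchy_convergent convergent_def by blast
  then obtain v where v: "\<And>x. (\<lambda>n. X n x) \<longlonglongrightarrow> v x" by metis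
  obtain K where K: "\<And>n. norm (X n) \<le> K" using Cauchy_Bseq[OF X] Bseq_def by metis
  have "bounded_linear v"
  proof (rule bounded_linear_intro)
    show "v (x + y) = v x + v y" for x y
      using tendsto_add[OF v[of x] v[of y]] v[of "x + y"]
      by (simp add: blinfun.add_right LIMSEQ_unique)
    show "v (r *\<^sub>R x) = r *\<^sub>R v x" for r x
      using tendsto_scaleR[OF tendsto_const[of r] v[of x]] v[of "r *\<^sub>R x"]
      by (simp add: blinfun.scaleR_right LIMSEQ_unique)
    show "norm (v x) \<le> norm x * K" for x
    proof (rule LIMSEQ_le_const2[OF tendsto_norm[OF v]])
      have "norm (X n x) \<le> norm x * K" for n
        using norm_blinfun[of "X n" x] mult_right_mono[OF K[of n] norm_ge_zero[of x]]
        by (simp add: mult.commute)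
      then show "\<exists>N. \<forall>n\<ge>N. norm (X n x) \<le> norm x * K" by blast
    qed
  qed
  then have V: "blinfun_apply (Blinfun v) = v" by (rule bounded_linear_Blinfun_apply)
  have "X \<longlonglongrightarrow> Blinfun v"
  proof (rule LIMSEQ_I)
    fix e :: real assume e: "0 < e"
    then obtain N where N: "\<And>m n. N \<le> m \<Longrightarrow> N \<le> n \<Longrightarrow> norm (X m - X n) < e / 2"
      using CauchyD[OF X, of "e / 2"] by auto
    \<comment> \<open>The pointwise Cauchy estimate survives \<open>m\<close> tending to infinity
      only as a weak inequality, hence \<open>e / 2\<close>.\<close>
    have "norm (X n - Blinfun v) \<le> e / 2" if n: "N \<le> n" for n
    proof (rule norm_blinfun_bound)
      fix x
      have "norm (X n x - X m x) \<le> e / 2 * norm x" if "N \<le> m" for m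
      proof -
        have "norm (X n x - X m x) \<le> norm (X n - X m) * norm x"
          using norm_blinfun[of "X n - X m" x] by (simp add: blinfun.diff_left)
        also have "\<dots> \<le> e / 2 * norm x"
          using N[OF n that] by (intro mult_right_mono) auto
        finally show ?thesis .
      qed
      then show "norm ((X n - Blinfun v) x) \<le> e / 2 * norm x"
        unfolding blinfun.diff_left V
        by (intro LIMSEQ_le_const2[OF tendsto_norm[OF tendsto_diff[OF tendsto_const v]]]) blast
    qed (use e in simp)
    then show "\<exists>N. \<forall>n\<ge>N. norm (X n - Blinfun v) < e"
      using e field_less_half_sum[of 0 e] by (intro exI[of _ N]) fastforce
  qed
  then show ?thesis by (rule convergentI)
qed

text \<open>A fixed point \<open>y\<close> satisfies \<open>y + y = B + y \<cdot> y\<close>, so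
  \<open>id_blinfun - y\<close> squares to \<open>id_blinfun - B\<close>.\<close>

fun sqrt_iter :: "'h::real_normed_vector op \<Rightarrow> nat \<Rightarrow> 'h op" where
  "sqrt_iter B 0 = 0"
| "sqrt_iter B (Suc n) = (1/2) *\<^sub>R (B + sqrt_iter B n \<cdot> sqrt_iter B n)"

fun sqrt_bound :: "nat \<Rightarrow> real" where
  "sqrt_bound 0 = 0"
| "sqrt_bound (Suc n) = (1 + sqrt_bound n * sqrt_bound n) / 2"

lemma sqrt_bound_range: "0 \<le> sqrt_bound n \<and> sqrt_bound n \<le> 1"
proof (induction n)
  case (Suc n)
  then have "sqrt_bound n * sqrt_bound n \<le> 1 * 1" by (intro mult_mono) auto
  then show ?case by simp
qed simp

lemma sqrt_iter_norm:
  assumes "norm B \<le> 1"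
  shows "norm (sqrt_iter B n) \<le> sqrt_bound n"
proof (induction n)
  case (Suc n)
  have "norm (B + sqrt_iter B n \<cdot> sqrt_iter B n)
      \<le> norm B + norm (sqrt_iter B n) * norm (sqrt_iter B n)"
    by (rule norm_triangle_ineq[THEN order_trans]) (intro add_left_mono norm_blinfun_compose)
  also have "\<dots> \<le> 1 + sqrt_bound n * sqrt_bound n"
    using assms Suc sqrt_bound_range[of n] by (intro add_mono mult_mono) auto
  finally show ?case by simp
qed simp

text \<open>The increments are majorised by those of the scalar iteration for \<open>B = 1\<close>, which is
  bounded and monotone; this gives norm convergence without any functional calculus.\<close>

lemma sqrt_iter_increment:
  assumes B: "norm B \<le> 1"
  shows "norm (sqrt_iter B (Suc n) - sqrt_iter B n) \<le> sqrt_bound (Suc n) - sqrt_bound n"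
proof (induction n)
  case (Suc n)
  define y z where "y = sqrt_iter B n" and "z = sqrt_iter B (Suc n)"
  define \<alpha> \<beta> where "\<alpha> = sqrt_bound n" and "\<beta> = sqrt_bound (Suc n)"
  have y: "norm y \<le> \<alpha>" and z: "norm z \<le> \<beta>" and pos: "0 \<le> \<alpha>" "0 \<le> \<beta>" and zy: "norm (z - y) \<le> \<beta> - \<alpha>"
    using sqrt_iter_norm[OF B] sqrt_bound_range Suc
    by (auto simp: y_def z_def \<alpha>_def \<beta>_def simp del: sqrt_bound.simps sqrt_iter.simps)
  have "sqrt_iter B (Suc (Suc n)) - sqrt_iter B (Suc n)
      = (1/2) *\<^sub>R (B + z \<cdot> z) - (1/2) *\<^sub>R (B + y \<cdot> y)"
    by (simp add: y_def z_def)
  \<comment> \<open>This splitting of the difference of squares holds without commutativity.\<close>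
  also have "\<dots> = (1/2) *\<^sub>R (z \<cdot> (z - y) + (z - y) \<cdot> y)"
    by (simp add: op_ring algebra_simps)
  finally have "norm (sqrt_iter B (Suc (Suc n)) - sqrt_iter B (Suc n))
      = norm (z \<cdot> (z - y) + (z - y) \<cdot> y) / 2" by simp
  also have "\<dots> \<le> (norm z * norm (z - y) + norm (z - y) * norm y) / 2"
    by (intro divide_right_mono norm_triangle_ineq[THEN order_trans] add_mono norm_blinfun_compose)
      auto
  also have "\<dots> \<le> (\<beta> * (\<beta> - \<alpha>) + (\<beta> - \<alpha>) * \<alpha>) / 2"
    using y z zy pos norm_ge_zero[of "z - y", THEN order_trans, OF zy]
    by (intro divide_right_mono add_mono mult_mono) auto
  also have "\<dots> = (1 + \<beta> * \<beta>) / 2 - (1 + \<alpha> * \<alpha>) / 2" by (simp add: field_simps)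
  also have "\<dots> = sqrt_bound (Suc (Suc n)) - sqrt_bound (Suc n)"
    by (simp add: \<alpha>_def \<beta>_def)
  finally show ?case .
qed (use B in simp)

lemma sqrt_iter_convergent:
  assumes B: "norm (B :: 'h::{real_normed_vector,complete_space} op) \<le> 1"
  shows "convergent (sqrt_iter B)"
proof -
  \<comment> \<open>The increment bounds telescope, so the Cauchy property carries over from the
    scalar sequence.\<close>
  have inc: "norm (sqrt_iter B n - sqrt_iter B m) \<le> sqrt_bound n - sqrt_bound m" if "m \<le> n" for m n
    using that
  proof (induction n rule: dec_induct)
    case (step n)
    have "norm (sqrt_iter B (Suc n) - sqrt_iter B m)
       \<le> norm (sqrt_iter B (Suc n) - sqrt_iter B n) + norm (sqrt_iter B n - sqrt_iter B m)"
      using norm_triangle_ineq[of "sqrt_iter B (Suc n) - sqrt_iter B n" "sqrt_iter B n - sqrt_iter B m"]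
      by (simp del: sqrt_iter.simps)
    then show ?case using step sqrt_iter_increment[OF B, of n] by linarith
  qed simp
  have "mono sqrt_bound"
    unfolding mono_def using inc by (meson norm_ge_zero diff_ge_0_iff_ge order_trans)
  then have "convergent sqrt_bound"
    using sqrt_bound_range by (intro Bseq_mono_convergent BseqI'[of _ 1]) (auto simp: mono_def)
  then have C: "Cauchy sqrt_bound" by (rule convergent_Cauchy)
  have "Cauchy (sqrt_iter B)"
  proof (rule CauchyI)
    fix e :: real assume "0 < e"
    then obtain N where N: "\<And>m n. N \<le> m \<Longrightarrow> N \<le> n \<Longrightarrow> norm (sqrt_bound m - sqrt_bound n) < e"
      using CauchyD[OF C] by blast
    have "norm (sqrt_iter B m - sqrt_iter B n) < e" if "N \<le> m" "N \<le> n" for m n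
      using inc[of m n] inc[of n m] N[OF that] norm_minus_commute[of "sqrt_iter B m" "sqrt_iter B n"]
      by (cases "m \<le> n") auto
    then show "\<exists>M. \<forall>m\<ge>M. \<forall>n\<ge>M. norm (sqrt_iter B m - sqrt_iter B n) < e" by blast
  qed
  then show ?thesis by (rule blinfun_Cauchy_convergent)
qed

text \<open>Self-adjointness, the norm bound and commutation with \<open>T\<close> hold for every
  iterate and pass to the norm limit.\<close>

lemma contraction_fixpoint:
  fixes B :: "'h::{real_inner,complete_space} op"
  assumes B: "norm B \<le> 1" "adj B = B"
  obtains y where "adj y = y" "norm y \<le> 1" "y + y = B + y \<cdot> y"
    "\<And>T. T \<cdot> B = B \<cdot> T \<Longrightarrow> T \<cdot> y = y \<cdot> T"
proof -
  obtain y where y: "sqrt_iter B \<longlonglongrightarrow> y"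
    using sqrt_iter_convergent[OF B(1)] convergent_def by blast
  have comp: "(\<lambda>n. f n \<cdot> g n) \<longlonglongrightarrow> k \<cdot> l"
    if "f \<longlonglongrightarrow> k" "g \<longlonglongrightarrow> l" for f g :: "nat \<Rightarrow> 'h op" and k l
    using bounded_bilinear.tendsto[OF bounded_bilinear_blinfun_compose that] .
  have "adj (sqrt_iter B n) = sqrt_iter B n" for n
    by (induction n) (simp_all add: B)
  then have "adj y = y"
    using LIMSEQ_unique[OF bounded_linear.tendsto[OF bounded_linear_adj y]] y by simp
  moreover have "norm (sqrt_iter B n) \<le> 1" for n
    using sqrt_iter_norm[OF B(1), of n] sqrt_bound_range[of n] by linarith
  then have "norm y \<le> 1" by (intro LIMSEQ_le_const2[OF tendsto_norm[OF y]]) auto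
  moreover have "y + y = B + y \<cdot> y"
  proof -
    have "(\<lambda>n. (1/2) *\<^sub>R (B + sqrt_iter B n \<cdot> sqrt_iter B n)) \<longlonglongrightarrow> (1/2) *\<^sub>R (B + y \<cdot> y)"
      by (intro tendsto_intros comp y)
    then have "sqrt_iter B \<longlonglongrightarrow> (1/2) *\<^sub>R (B + y \<cdot> y)"
      by (subst filterlim_sequentially_Suc[symmetric]) simp
    with y have "y = (1/2) *\<^sub>R (B + y \<cdot> y)" by (rule LIMSEQ_unique)
    then have "2 *\<^sub>R y = 2 *\<^sub>R ((1/2) *\<^sub>R (B + y \<cdot> y))" by simp
    then show ?thesis by (simp add: scaleR_2)
  qed
  moreover have "T \<cdot> y = y \<cdot> T" if T: "T \<cdot> B = B \<cdot> T" for T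
  proof -
    have "T \<cdot> sqrt_iter B n = sqrt_iter B n \<cdot> T" for n
    proof (induction n)
      case (Suc n)
      have "T \<cdot> (sqrt_iter B n \<cdot> sqrt_iter B n) = (sqrt_iter B n \<cdot> sqrt_iter B n) \<cdot> T"
        by (metis Suc blinfun_compose_assoc)
      then show ?case by (simp add: compose_bilinear T)
    qed simp
    then have "(\<lambda>n. T \<cdot> sqrt_iter B n) \<longlonglongrightarrow> y \<cdot> T"
      using comp[OF y tendsto_const[of T]] by simp
    then show ?thesis using comp[OF tendsto_const[of T] y] LIMSEQ_unique by blast
  qed
  ultimately show ?thesis by (rule that)
qed

text \<open>Rescaling puts \<open>C\<close> between 0 and 1, so \<open>B = id_blinfun - C\<close> is
  a contraction and its fixed point gives the root \<open>id_blinfun - y\<close> of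
  \<open>C\<close>.\<close>

lemma positive_sqrt_exists:
  assumes A: "positive A"
  obtains r where "positive r" "r \<cdot> r = A" "\<And>T. T \<cdot> A = A \<cdot> T \<Longrightarrow> T \<cdot> r = r \<cdot> T"
proof -
  \<comment> \<open>The \<open>+ 1\<close> keeps the scale positive for
    \<open>A = 0\<close>.\<close>
  define k where "k = norm A + 1"
  have k: "0 < k" by (simp add: k_def add_nonneg_pos)
  define C where "C = (1/k) *\<^sub>R A"
  have C: "positive C" unfolding C_def using A k by (intro positive_scaleR) auto
  have "norm C \<le> 1" using k by (simp add: C_def k_def divide_simps)
  then have "positive (id_blinfun - C)" by (intro positive_diff_norm positive_adj C)
  with C have unit: "unit_interval_op (id_blinfun - C)" by (simp add: unit_interval_op_def)
  have sa: "adj (id_blinfun - C) = id_blinfun - C" by (simp add: positive_adj[OF C])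
  obtain y where y: "adj y = y" "norm y \<le> 1" "y + y = (id_blinfun - C) + y \<cdot> y"
    "\<And>T. T \<cdot> (id_blinfun - C) = (id_blinfun - C) \<cdot> T \<Longrightarrow> T \<cdot> y = y \<cdot> T"
    using contraction_fixpoint[OF unit_interval_norm_le_1[OF unit] sa] by blast
  define r where "r = sqrt k *\<^sub>R (id_blinfun - y)"
  have "positive r"
    unfolding r_def using k y(1,2) by (intro positive_scaleR positive_diff_norm) auto
  moreover have "r \<cdot> r = A"
  proof -
    have "(id_blinfun - y) \<cdot> (id_blinfun - y) = C"
      using y(3) by (simp add: op_ring algebra_simps)
    then have "r \<cdot> r = k *\<^sub>R C" using k by (simp add: r_def compose_bilinear(7,8))
    then show ?thesis using k by (simp add: C_def)
  qed
  moreover have "T \<cdot> r = r \<cdot> T" if "T \<cdot> A = A \<cdot> T" for T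
    using y(4)[of T] that by (simp add: r_def C_def op_ring)
  ultimately show ?thesis by (rule that)
qed

text \<open>With \<open>d = r - s\<close>, commutation gives \<open>d \<cdot> (r + s) = 0\<close>.
  So the positive operators \<open>d \<cdot> r \<cdot> d\<close> and
  \<open>d \<cdot> s \<cdot> d\<close> sum to zero and both vanish; their difference is the cube of
  \<open>d\<close>, and a self-adjoint nilpotent is zero.\<close>

lemma positive_sqrt_unique:
  assumes r: "positive r" "r \<cdot> r = A" and s: "positive s" "s \<cdot> s = A"
    and comm: "s \<cdot> r = r \<cdot> s"
  shows "s = r"
proof -
  define d where "d = r - s"
  have d: "adj d = d" by (simp add: d_def positive_adj r s)
  have "d \<cdot> (r + s) = 0" by (simp add: d_def op_ring r s comm)
  then have "d \<cdot> (r + s) \<cdot> d = 0" by simp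
  then have sum: "inner ((d \<cdot> r \<cdot> d) x) x + inner ((d \<cdot> s \<cdot> d) x) x = 0" for x
    by (metis (no_types, lifting) compose_bilinear(1,2) blinfun.add_left inner_add_left
        blinfun.zero_left inner_zero_left)
  have pos: "positive (d \<cdot> r \<cdot> d)" "positive (d \<cdot> s \<cdot> d)"
    using positive_conj[OF r(1), of d] positive_conj[OF s(1), of d] by (simp_all add: d)
  have "inner ((d \<cdot> r \<cdot> d) x) x = 0 \<and> inner ((d \<cdot> s \<cdot> d) x) x = 0" for x
    using sum[of x] positive_nonneg[OF pos(1), of x] positive_nonneg[OF pos(2), of x] by linarith
  then have "d \<cdot> r \<cdot> d = 0" "d \<cdot> s \<cdot> d = 0"
    using pos by (auto intro!: self_adjoint_eqI simp only: positive_adj)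
  then have "d \<cdot> d \<cdot> d = 0" by (simp add: d_def op_ring)
  then have "(d \<cdot> d) \<cdot> (d \<cdot> d) = 0" by (simp flip: blinfun_compose_assoc)
  then have "d \<cdot> d = 0" by (rule self_adjoint_square_zero[rotated]) (simp add: d)
  then have "d = 0" by (rule self_adjoint_square_zero[OF d])
  then show ?thesis by (simp add: d_def)
qed

section \<open>Absolute values\<close>

lemma op_abs_eqI:
  assumes r: "positive r" "r \<cdot> r = adj x \<cdot> x"
  shows "op_abs x = r"
  unfolding op_abs_def
proof (rule the_equality)
  obtain q where q: "positive q" "q \<cdot> q = adj x \<cdot> x"
    and comm: "\<And>T. T \<cdot> (adj x \<cdot> x) = (adj x \<cdot> x) \<cdot> T \<Longrightarrow> T \<cdot> q = q \<cdot> T"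
    using positive_sqrt_exists[OF positive_adj_compose] by blast
  \<comment> \<open>Any root \<open>s\<close> commutes with its own square, hence with
    \<open>q\<close>, which makes commuting uniqueness applicable.\<close>
  have eq: "s = q" if s: "positive s" "s \<cdot> s = adj x \<cdot> x" for s
    by (rule positive_sqrt_unique[OF q s]) (rule comm, simp add: blinfun_compose_assoc flip: s(2))
  show "s = r" if "positive s \<and> s \<cdot> s = adj x \<cdot> x" for s
    using eq[of s] eq[of r] that r by simp
qed (use r in simp)

lemma
  shows op_abs_positive: "positive (op_abs x)"
    and op_abs_square: "op_abs x \<cdot> op_abs x = adj x \<cdot> x"
    and op_abs_commute: "T \<cdot> (adj x \<cdot> x) = (adj x \<cdot> x) \<cdot> T \<Longrightarrow> T \<cdot> op_abs x = op_abs x \<cdot> T"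
proof -
  obtain q where q: "positive q" "q \<cdot> q = adj x \<cdot> x"
    and comm: "\<And>T. T \<cdot> (adj x \<cdot> x) = (adj x \<cdot> x) \<cdot> T \<Longrightarrow> T \<cdot> q = q \<cdot> T"
    using positive_sqrt_exists[OF positive_adj_compose] by blast
  have eq: "op_abs x = q" by (rule op_abs_eqI[OF q])
  show "positive (op_abs x)" "op_abs x \<cdot> op_abs x = adj x \<cdot> x" unfolding eq by (fact q)+
  show "T \<cdot> op_abs x = op_abs x \<cdot> T" if "T \<cdot> (adj x \<cdot> x) = (adj x \<cdot> x) \<cdot> T"
    unfolding eq using that by (rule comm)
qed

section \<open>Range projections\<close>

lemma projection_onto_closed_subspace:
  fixes S :: "'h::{real_inner,complete_space} set"
  assumes S: "subspace S" "closed S"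
  obtains p where "is_projection p" "range (blinfun_apply p) = S"
proof -
  \<comment> \<open>The projection of \<open>v\<close> is the vector of \<open>S\<close>
    representing the functional \<open>inner x v\<close> on \<open>S\<close>.\<close>
  have "\<exists>z\<in>S. \<forall>x\<in>S. inner x v = inner x z" for v
  proof -
    have "bounded_linear (\<lambda>x. inner x v)" by (rule bounded_linear_inner_left)
    then obtain z where "z \<in> S" "\<And>x. x \<in> S \<Longrightarrow> inner x v = inner x z"
      by (rule riesz_closed_subspace[OF S]) (rule that)
    then show ?thesis by blast
  qed
  then obtain P where PS: "\<And>v. P v \<in> S" and P: "\<And>x v. x \<in> S \<Longrightarrow> inner x v = inner x (P v)"
    by metis
  have sym: "inner (P x) y = inner x (P y)" for x y
    using P[OF PS[of x], of y] P[OF PS[of y], of x] by (simp add: inner_commute)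
  have "norm (P v) \<le> norm v * 1" for v
  proof (cases "P v = 0")
    case False
    have "norm (P v) * norm (P v) = inner (P v) v"
      using P[OF PS[of v], of v] by (simp add: norm_eq_sqrt_inner)
    also have "\<dots> \<le> norm (P v) * norm v" by (rule norm_cauchy_schwarz)
    finally show ?thesis using False by simp
  qed simp
  then have bl: "bounded_linear P" by (rule formal_adjoint_bounded_linear[OF sym])
  have fix_S: "P v = v" if v: "v \<in> S" for v
  proof -
    have "v - P v \<in> S" using v PS S(1) by (intro subspace_diff)
    from P[OF this, of v] have "inner (v - P v) (v - P v) = 0" by (simp add: inner_diff_right)
    then show ?thesis by simp
  qed
  define p where "p = Blinfun P"
  have p: "blinfun_apply p = P" using bl by (simp add: p_def bounded_linear_Blinfun_apply)
  have "is_projection p"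
    unfolding is_projection_def
  proof
    show "p \<cdot> p = p" by (rule blinfun_eqI) (simp add: p fix_S PS)
    show "adj p = p" by (rule adj_eqI) (simp add: p sym)
  qed
  moreover have "range p = S" using PS fix_S unfolding p by (metis image_subset_iff rangeI subsetI subset_antisym)
  ultimately show ?thesis by (rule that)
qed

lemma subspace_closure:
  fixes S :: "'a::real_normed_vector set"
  assumes S: "subspace S"
  shows "subspace (closure S)"
proof (rule subspaceI)
  show "0 \<in> closure S" using subspace_0[OF S] closure_subset by blast
  show "x + y \<in> closure S" if xy: "x \<in> closure S" "y \<in> closure S" for x y
  proof -
    obtain f g where "\<And>n. f n \<in> S" "f \<longlonglongrightarrow> x" "\<And>n. g n \<in> S" "g \<longlonglongrightarrow> y"
      using xy by (auto simp: closure_sequential)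
    then show ?thesis
      using subspace_add[OF S] tendsto_add
      by (fastforce simp: closure_sequential intro!: exI[of _ "\<lambda>n. f n + g n"])
  qed
  show "c *\<^sub>R x \<in> closure S" if x: "x \<in> closure S" for c x
  proof -
    obtain f where "\<And>n. f n \<in> S" "f \<longlonglongrightarrow> x"
      using x by (auto simp: closure_sequential)
    then show ?thesis
      using subspace_mul[OF S] tendsto_scaleR[OF tendsto_const]
      by (fastforce simp: closure_sequential intro!: exI[of _ "\<lambda>n. c *\<^sub>R f n"])
  qed
qed

text \<open>The projection onto the closure of the range of \<open>e\<close>. Annihilation of
  \<open>e\<close> extends to the closure by continuity; an operator commuting with \<open>e\<close>
  together with its adjoint reduces that closure.\<close>

lemma range_projection_exists:
  fixes e :: "'h::{real_inner,complete_space} op"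
  obtains p where "is_projection p" "p \<cdot> e = e"
    "\<And>T::'h op. T \<cdot> e = 0 \<Longrightarrow> T \<cdot> p = 0"
    "\<And>T. T \<cdot> e = e \<cdot> T \<Longrightarrow> adj T \<cdot> e = e \<cdot> adj T \<Longrightarrow> T \<cdot> p = p \<cdot> T"
proof -
  have "subspace (range e)"
    by (intro linear_subspace_image bounded_linear.linear[OF blinfun.bounded_linear_right] subspace_UNIV)
  then have "subspace (closure (range e))" by (rule subspace_closure)
  from projection_onto_closed_subspace[OF this closed_closure]
  obtain p where p: "is_projection p" and rp: "range p = closure (range e)" by blast
  have pp: "p \<cdot> p = p" and ap: "adj p = p" using p by (auto simp: is_projection_def)
  have fix_p: "p x = x" if "x \<in> closure (range e)" for x
    using that pp unfolding rp[symmetric] by (metis blinfun_apply_blinfun_compose imageE)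
  have pe: "p \<cdot> e = e"
    by (rule blinfun_eqI) (simp add: fix_p subsetD[OF closure_subset])
  have ann: "T \<cdot> p = 0" if T: "T \<cdot> e = 0" for T
  proof -
    have "T (e x) = 0" for x by (metis T blinfun_apply_blinfun_compose blinfun.zero_left)
    then have *: "T y = 0" if "y \<in> range e" for y using that by auto
    have "T y = 0" if "y \<in> closure (range e)" for y
      by (rule continuous_constant_on_closure[OF _ * that])
        (intro blinfun.continuous_on continuous_on_const continuous_on_id)
    then show ?thesis using rp by (intro blinfun_eqI) auto
  qed
  \<comment> \<open>Invariance of the range of \<open>p\<close>: \<open>T - p \<cdot> T\<close>
    annihilates \<open>e\<close>, hence \<open>p\<close>.\<close>
  have inv: "p \<cdot> T \<cdot> p = T \<cdot> p" if "T \<cdot> e = e \<cdot> T" for T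
  proof -
    have "(T - p \<cdot> T) \<cdot> e = 0"
      by (simp add: op_ring that) (simp add: pe flip: blinfun_compose_assoc)
    from ann[OF this] show ?thesis by (simp add: op_ring)
  qed
  have "T \<cdot> p = p \<cdot> T" if "T \<cdot> e = e \<cdot> T" "adj T \<cdot> e = e \<cdot> adj T" for T
  proof -
    \<comment> \<open>Invariance under \<open>adj T\<close> turns into the mirrored identity for
      \<open>T\<close>.\<close>
    have "adj (p \<cdot> adj T \<cdot> p) = adj (adj T \<cdot> p)" by (simp add: inv that)
    then have "p \<cdot> T \<cdot> p = p \<cdot> T" by (simp add: ap blinfun_compose_assoc)
    then show ?thesis using inv[OF that(1)] by simp
  qed
  with p pe ann show ?thesis by (rule that)
qed

section \<open>Membership in the von Neumann algebra\<close>

lemma self_adjoint_commute_adj: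
  assumes "adj e = e" "T \<cdot> e = e \<cdot> T"
  shows "adj T \<cdot> e = e \<cdot> adj T"
proof -
  have "adj (T \<cdot> e) = adj (e \<cdot> T)" by (simp only: assms)
  then show ?thesis by (simp only: adj_compose assms(1))
qed

text \<open>The bicommutant condition reduces membership to commutation with \<open>J\<close> and
  with the commutant.\<close>

lemma von_neumann_algebra_memI:
  assumes "von_neumann_algebra J M" "x \<cdot> J = J \<cdot> x"
    and "\<And>T. T \<in> commutant J M \<Longrightarrow> x \<cdot> T = T \<cdot> x"
  shows "x \<in> M"
proof -
  have "x \<in> commutant J (commutant J M)" using assms by (simp add: commutant_def bops_def)
  then show ?thesis using assms(1) by (simp add: von_neumann_algebra_def)
qed

lemma von_neumann_algebra_commute_J:
  "von_neumann_algebra J M \<Longrightarrow> x \<in> M \<Longrightarrow> x \<cdot> J = J \<cdot> x"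
  by (auto simp: von_neumann_algebra_def bops_def)

lemma commutant_commute: "T \<in> commutant J M \<Longrightarrow> x \<in> M \<Longrightarrow> x \<cdot> T = T \<cdot> x"
  by (simp add: commutant_def)

lemma jordan_commute:
  assumes "a \<cdot> T = T \<cdot> a" "b \<cdot> T = T \<cdot> b"
  shows "jordan a b \<cdot> T = T \<cdot> jordan a b"
proof -
  have "a \<cdot> b \<cdot> T = T \<cdot> (a \<cdot> b)" "b \<cdot> a \<cdot> T = T \<cdot> (b \<cdot> a)"
    by (simp_all add: blinfun_compose_assoc assms compose_eq_rewrite[OF assms(1)]
        compose_eq_rewrite[OF assms(2)])
  then show ?thesis by (simp add: jordan_def compose_bilinear)
qed

lemma jordan_mem:
  assumes vN: "von_neumann_algebra J M" and "a \<in> M" "b \<in> M"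
  shows "jordan a b \<in> M"
proof (rule von_neumann_algebra_memI[OF vN])
  show "jordan a b \<cdot> J = J \<cdot> jordan a b"
    using assms by (intro jordan_commute von_neumann_algebra_commute_J[OF vN])
  show "jordan a b \<cdot> T = T \<cdot> jordan a b" if "T \<in> commutant J M" for T
    using assms by (intro jordan_commute commutant_commute[OF that])
qed

text \<open>\<open>J\<close> and the commutant commute with \<open>e\<close>, hence with
  \<open>p\<close>, so \<open>p\<close> lies in \<open>M\<close>. Minimality is the annihilation
  property for \<open>id_blinfun - q\<close>.\<close>

lemma von_neumann_algebra_range_projection:
  fixes e :: "'h::{real_inner,complete_space} op"
  assumes vN: "von_neumann_algebra J M" and e: "e \<in> M" "adj e = e"
  obtains p where "is_range_projection M e p"
    "\<And>T::'h op. T \<cdot> e = 0 \<Longrightarrow> T \<cdot> p = 0"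
    "\<And>T. T \<cdot> e = e \<cdot> T \<Longrightarrow> T \<cdot> p = p \<cdot> T"
proof -
  obtain p where p: "is_projection p" "p \<cdot> e = e"
    and ann: "\<And>T::'h op. T \<cdot> e = 0 \<Longrightarrow> T \<cdot> p = 0"
    and "\<And>T. T \<cdot> e = e \<cdot> T \<Longrightarrow> adj T \<cdot> e = e \<cdot> adj T \<Longrightarrow> T \<cdot> p = p \<cdot> T"
    using range_projection_exists[of e] by blast
  then have comm: "T \<cdot> p = p \<cdot> T" if "T \<cdot> e = e \<cdot> T" for T
    using that self_adjoint_commute_adj[OF e(2)] by blast
  have "p \<in> M"
  proof (rule von_neumann_algebra_memI[OF vN])
    show "p \<cdot> J = J \<cdot> p"
      by (rule comm[symmetric]) (rule von_neumann_algebra_commute_J[OF vN e(1), symmetric])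
    show "p \<cdot> T = T \<cdot> p" if "T \<in> commutant J M" for T
      by (rule comm[symmetric]) (rule commutant_commute[OF that e(1), symmetric])
  qed
  moreover have "q \<cdot> p = p" if "q \<cdot> e = e" for q
    using ann[of "id_blinfun - q"] that by (simp add: compose_bilinear)
  ultimately have "is_range_projection M e p"
    using p by (simp add: is_range_projection_def)
  then show ?thesis using ann comm by (rule that)
qed

section \<open>Absolute compatibility\<close>

lemma absolutely_compatible_midpoint:
  fixes a b :: "'h::{real_inner,complete_space} op"
  assumes sa: "adj a = a" "adj b = b" and ac: "absolutely_compatible a b"
  obtains k h v where "a = k + h" "b = k - h" "adj v = v" "h \<cdot> h = v \<cdot> v" "h \<cdot> v = v \<cdot> h"
    "k \<cdot> v = v \<cdot> k" "k \<cdot> k = k - v + v \<cdot> v" "jordan a b = k - v"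
proof -
  define k h v where "k = (1/2) *\<^sub>R (a + b)" and "h = (1/2) *\<^sub>R (a - b)"
    and "v = (1/2) *\<^sub>R op_abs (a - b)"
  have k2: "a + b = k + k" and h2: "a - b = h + h" and v2: "op_abs (a - b) = v + v"
    by (simp_all add: k_def h_def v_def flip: scaleR_2)
  have ab: "a = k + h" "b = k - h"
    unfolding k_def h_def by (simp_all flip: scaleR_add_right scaleR_diff_right scaleR_2)
  \<comment> \<open>Absolute compatibility, solved for the second absolute value.\<close>
  have w2: "op_abs (id_blinfun - a - b) = id_blinfun - (v + v)"
    using ac by (simp add: absolutely_compatible_def v2 algebra_simps)
  have s2: "id_blinfun - a - b = id_blinfun - (k + k)" using k2 by (simp add: algebra_simps)
  have four: "4 *\<^sub>R x = x + x + (x + x)" for x :: "'h op"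
    using scaleR_add_left[of 2 2 x] by (simp add: scaleR_2)
  have "(v + v) \<cdot> (v + v) = (h + h) \<cdot> (h + h)"
    using op_abs_square[of "a - b"] unfolding v2 unfolding adj_diff sa unfolding h2 .
  moreover have "4 *\<^sub>R (h \<cdot> h) - 4 *\<^sub>R (v \<cdot> v) = (h + h) \<cdot> (h + h) - (v + v) \<cdot> (v + v)"
    by (simp add: four op_ring)
  ultimately have hh: "h \<cdot> h = v \<cdot> v" by simp
  \<comment> \<open>A self-adjoint operator commutes with its square, hence with its absolute
    value.\<close>
  have "(a - b) \<cdot> op_abs (a - b) = op_abs (a - b) \<cdot> (a - b)"
    by (rule op_abs_commute) (simp add: sa blinfun_compose_assoc)
  then have hv: "h \<cdot> v = v \<cdot> h" by (simp add: h_def v_def compose_bilinear(7,8))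
  have "(id_blinfun - (v + v)) \<cdot> (id_blinfun - (v + v)) = (id_blinfun - (k + k)) \<cdot> (id_blinfun - (k + k))"
    using op_abs_square[of "id_blinfun - a - b"] unfolding w2 unfolding adj_diff adj_id sa unfolding s2 .
  moreover have "4 *\<^sub>R (k \<cdot> k) - 4 *\<^sub>R (k - v + v \<cdot> v)
      = (id_blinfun - (k + k)) \<cdot> (id_blinfun - (k + k)) - (id_blinfun - (v + v)) \<cdot> (id_blinfun - (v + v))"
    by (simp add: four op_ring algebra_simps)
  ultimately have kk: "k \<cdot> k = k - v + v \<cdot> v" by simp
  have "(id_blinfun - a - b) \<cdot> op_abs (id_blinfun - a - b)
      = op_abs (id_blinfun - a - b) \<cdot> (id_blinfun - a - b)"
    by (rule op_abs_commute) (simp add: sa blinfun_compose_assoc)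
  then have "(id_blinfun - (k + k)) \<cdot> (id_blinfun - (v + v))
      = (id_blinfun - (v + v)) \<cdot> (id_blinfun - (k + k))" unfolding w2 unfolding s2 .
  moreover have "4 *\<^sub>R (k \<cdot> v) - 4 *\<^sub>R (v \<cdot> k)
      = (id_blinfun - (k + k)) \<cdot> (id_blinfun - (v + v)) - (id_blinfun - (v + v)) \<cdot> (id_blinfun - (k + k))"
    by (simp add: four op_ring algebra_simps)
  ultimately have kv: "k \<cdot> v = v \<cdot> k" by simp
  \<comment> \<open>Symmetrising cancels the mixed words in \<open>k\<close> and
    \<open>h\<close>.\<close>
  have "a \<cdot> b + b \<cdot> a = 2 *\<^sub>R (k \<cdot> k - h \<cdot> h)"
    by (simp add: ab scaleR_2 op_ring algebra_simps)
  then have "jordan a b = k - v" by (simp add: jordan_def kk hh)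
  moreover have "adj v = v" by (simp add: v_def positive_adj[OF op_abs_positive])
  ultimately show ?thesis by (intro that[OF ab _ hh hv kv kk])
qed

text \<open>Here \<open>p \<cdot> a \<cdot> q = p \<cdot> h \<cdot> q\<close>, while the diagonal
  blocks of \<open>p - a\<close> on \<open>p\<close> and of \<open>a\<close> on \<open>q\<close> are
  those of \<open>v - h\<close> and \<open>v + h\<close>; for \<open>b\<close> the sign of
  \<open>h\<close> flips. Since \<open>v\<close> commutes with \<open>p\<close> and
  \<open>h\<close>, only \<open>h \<cdot> h = v \<cdot> v\<close> remains to be used.\<close>

lemma compatible_block_identities:
  assumes p: "p \<cdot> p = p" and v: "p \<cdot> v = v \<cdot> p" and h: "h \<cdot> v = v \<cdot> h" "h \<cdot> h = v \<cdot> v"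
    and a: "a = p + v - v \<cdot> p - v \<cdot> p + h" and b: "b = p + v - v \<cdot> p - v \<cdot> p - h"
    and q: "q = id_blinfun - p"
  shows "p \<cdot> a \<cdot> q + p \<cdot> b \<cdot> q = 0"
    and "(p \<cdot> a \<cdot> q) \<cdot> (q \<cdot> a \<cdot> p) = (p - p \<cdot> a \<cdot> p) \<cdot> (p - p \<cdot> b \<cdot> p)"
    and "(q \<cdot> a \<cdot> p) \<cdot> (p \<cdot> a \<cdot> q) = (q \<cdot> a \<cdot> q) \<cdot> (q \<cdot> b \<cdot> q)"
    and "(q \<cdot> a \<cdot> q) \<cdot> (q \<cdot> b \<cdot> q) = (q \<cdot> b \<cdot> q) \<cdot> (q \<cdot> a \<cdot> q)"
    and "p \<cdot> a \<cdot> q = (p \<cdot> a \<cdot> p) \<cdot> (p \<cdot> a \<cdot> q) + (p \<cdot> a \<cdot> q) \<cdot> (q \<cdot> a \<cdot> q)"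
    and "p \<cdot> a \<cdot> q = (p \<cdot> b \<cdot> p) \<cdot> (p \<cdot> a \<cdot> q) + (p \<cdot> a \<cdot> q) \<cdot> (q \<cdot> b \<cdot> q)"
  unfolding a b q
  by (simp_all add: op_ring p v h compose_eq_rewrite[OF p] compose_eq_rewrite[OF v]
      compose_eq_rewrite[OF h(1)] compose_eq_rewrite[OF h(2)] algebra_simps)

lemma absolutely_compatible_range_projection:
  fixes a b p :: "'h::{real_inner,complete_space} op"
  assumes sa: "adj a = a" "adj b = b" and ac: "absolutely_compatible a b"
    and p: "p \<cdot> p = p" "p \<cdot> jordan a b = jordan a b"
    and ann: "\<And>T::'h op. T \<cdot> jordan a b = 0 \<Longrightarrow> T \<cdot> p = 0"
    and comm: "\<And>T. T \<cdot> jordan a b = jordan a b \<cdot> T \<Longrightarrow> T \<cdot> p = p \<cdot> T"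
  obtains v h where "p \<cdot> v = v \<cdot> p" "h \<cdot> v = v \<cdot> h" "h \<cdot> h = v \<cdot> v"
    "a = p + v - v \<cdot> p - v \<cdot> p + h" "b = p + v - v \<cdot> p - v \<cdot> p - h"
proof -
  obtain k h v where kh: "a = k + h" "b = k - h" and hv: "h \<cdot> h = v \<cdot> v" "h \<cdot> v = v \<cdot> h"
    and kv: "k \<cdot> v = v \<cdot> k" and kk: "k \<cdot> k = k - v + v \<cdot> v" and e: "jordan a b = k - v"
    using absolutely_compatible_midpoint[OF sa ac] by metis
  \<comment> \<open>The product of \<open>id_blinfun - k - v\<close> and \<open>k - v\<close>
    vanishes by \<open>kv\<close> and \<open>kk\<close>.\<close>
  have "(id_blinfun - k - v) \<cdot> p = 0"
    by (rule ann) (simp add: e op_ring kv kk)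
  then have kp: "k \<cdot> p = p - v \<cdot> p" by (simp add: op_ring algebra_simps)
  have pv: "p \<cdot> v = v \<cdot> p" and pk: "p \<cdot> k = k \<cdot> p"
    by (rule comm[symmetric], simp add: e compose_bilinear kv)+
  have "k - v = p - v \<cdot> p - v \<cdot> p"
    using p(2) by (simp add: e compose_bilinear pv pk kp)
  then have "k = p + v - v \<cdot> p - v \<cdot> p" by (simp add: algebra_simps)
  then show ?thesis using that[OF pv hv(2) hv(1)] kh by simp
qed

section \<open>From block identities to absolute compatibility\<close>

lemma block_identities_compatible:
  assumes a01: "unit_interval_op a" and b01: "unit_interval_op b"
    and p: "is_projection p" and q: "q = id_blinfun - p"
    and b2: "p \<cdot> a \<cdot> q + p \<cdot> b \<cdot> q = 0"
    and b3: "(p \<cdot> a \<cdot> q) \<cdot> (q \<cdot> a \<cdot> p) = (p - p \<cdot> a \<cdot> p) \<cdot> (p - p \<cdot> b \<cdot> p)"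
    and b4: "(q \<cdot> a \<cdot> p) \<cdot> (p \<cdot> a \<cdot> q) = (q \<cdot> a \<cdot> q) \<cdot> (q \<cdot> b \<cdot> q)"
      "(q \<cdot> a \<cdot> q) \<cdot> (q \<cdot> b \<cdot> q) = (q \<cdot> b \<cdot> q) \<cdot> (q \<cdot> a \<cdot> q)"
    and b5: "p \<cdot> a \<cdot> q = (p \<cdot> a \<cdot> p) \<cdot> (p \<cdot> a \<cdot> q) + (p \<cdot> a \<cdot> q) \<cdot> (q \<cdot> a \<cdot> q)"
      "p \<cdot> a \<cdot> q = (p \<cdot> b \<cdot> p) \<cdot> (p \<cdot> a \<cdot> q) + (p \<cdot> a \<cdot> q) \<cdot> (q \<cdot> b \<cdot> q)"
  shows "absolutely_compatible a b"
proof -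
  have pos: "positive a" "positive b" "positive (id_blinfun - a)" "positive (id_blinfun - b)"
    using a01 b01 by (auto simp: unit_interval_op_def)
  have sa: "adj a = a" "adj b = b" using pos by (auto intro: positive_adj)
  have pp: "p \<cdot> p = p" and ap: "adj p = p" using p by (auto simp: is_projection_def)
  have aq: "adj q = q" by (simp add: q ap)
  \<comment> \<open>\<open>r\<close> and \<open>r'\<close> are the off-diagonal blocks of
    \<open>a\<close>; the other letters are the four positive diagonal blocks that sum to
    \<open>u\<close>.\<close>
  define r x y z t where "r = p \<cdot> a \<cdot> q" and "x = p - p \<cdot> a \<cdot> p" and "y = p - p \<cdot> b \<cdot> p"
    and "z = q \<cdot> a \<cdot> q" and "t = q \<cdot> b \<cdot> q"
  define r' where "r' = q \<cdot> a \<cdot> p"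
  have adjs: "adj r = r'" "adj r' = r" "adj x = x" "adj y = y" "adj z = z" "adj t = t"
    by (simp_all add: r_def r'_def x_def y_def z_def t_def ap aq sa blinfun_compose_assoc)
  have pq: "p \<cdot> q = 0" "q \<cdot> p = 0" "q \<cdot> q = q" by (simp_all add: q compose_bilinear pp)
  note blk = pp pq compose_eq_rewrite[OF pp] compose_eq_rewrite[OF pq(1)] compose_eq_rewrite[OF pq(2)]
    compose_eq_rewrite[OF pq(3)]
  have units: "p \<cdot> x = x" "x \<cdot> p = x" "p \<cdot> y = y" "y \<cdot> p = y" "p \<cdot> r = r" "r' \<cdot> p = r'"
    "r \<cdot> p = 0" "p \<cdot> r' = 0" "p \<cdot> z = 0" "z \<cdot> p = 0" "p \<cdot> t = 0" "t \<cdot> p = 0"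
    by (simp_all add: r_def r'_def x_def y_def z_def t_def op_ring blk)
  have zeros: "x \<cdot> r' = 0" "x \<cdot> z = 0" "x \<cdot> t = 0" "y \<cdot> r' = 0" "y \<cdot> z = 0" "y \<cdot> t = 0"
    "r \<cdot> x = 0" "r \<cdot> y = 0" "r \<cdot> r = 0" "r' \<cdot> r' = 0" "r' \<cdot> z = 0" "r' \<cdot> t = 0"
    "z \<cdot> x = 0" "z \<cdot> y = 0" "z \<cdot> r = 0" "t \<cdot> x = 0" "t \<cdot> y = 0" "t \<cdot> r = 0"
    by (simp_all add: r_def r'_def x_def y_def z_def t_def op_ring blk)
  have br: "p \<cdot> b \<cdot> q = - r" unfolding r_def by (rule minus_unique[OF b2, symmetric])
  have br': "q \<cdot> b \<cdot> p = - r'"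
  proof -
    have "adj (p \<cdot> b \<cdot> q) = - r'" using br adj_diff[of 0 r] by (simp add: adjs)
    then show ?thesis by (simp add: ap aq sa blinfun_compose_assoc)
  qed
  have a_eq: "a = p - x + r + r' + z"
    by (simp add: r_def r'_def x_def z_def q op_ring algebra_simps)
  have "b = p - y + p \<cdot> b \<cdot> q + q \<cdot> b \<cdot> p + t"
    by (simp add: y_def t_def q op_ring algebra_simps)
  then have b_eq: "b = p - y - r - r' + t" by (simp add: br br')
  have rr': "r \<cdot> r' = x \<cdot> y" using b3 by (simp add: r_def r'_def x_def y_def)
  \<comment> \<open>As \<open>r \<cdot> r'\<close> is self-adjoint, so is
    \<open>x \<cdot> y\<close>; hence \<open>x\<close> and \<open>y\<close> commute.\<close>
  have "adj (r \<cdot> r') = adj (x \<cdot> y)" by (simp only: rr')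
  then have yx: "y \<cdot> x = x \<cdot> y" unfolding adj_compose adjs unfolding rr' by (rule sym)
  have r'r: "r' \<cdot> r = z \<cdot> t" using b4(1) by (simp add: r_def r'_def z_def t_def)
  have tz: "t \<cdot> z = z \<cdot> t" using b4(2) by (simp add: z_def t_def)
  \<comment> \<open>Cancelling \<open>r\<close> turns (b.5) into an intertwining relation between
    diagonal blocks; its adjoint treats \<open>r'\<close>.\<close>
  have "r = (p - x) \<cdot> r + r \<cdot> z" using b5(1) by (simp add: r_def x_def z_def)
  then have xr: "x \<cdot> r = r \<cdot> z" by (simp add: compose_bilinear units)
  have "r = (p - y) \<cdot> r + r \<cdot> t" using b5(2) by (simp add: r_def y_def t_def)
  then have yr: "y \<cdot> r = r \<cdot> t" by (simp add: compose_bilinear units)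
  have "adj (x \<cdot> r) = adj (r \<cdot> z)" "adj (y \<cdot> r) = adj (r \<cdot> t)" by (simp_all only: xr yr)
  then have zr': "z \<cdot> r' = r' \<cdot> x" and tr': "t \<cdot> r' = r' \<cdot> y" by (simp_all add: adjs)
  note rels = units units[THEN compose_eq_rewrite] zeros rr' yx r'r tz xr yr zr' tr' pp
  define u where "u = x + y + z + t"
  have "positive x" "positive y"
    using positive_conj[OF pos(3), of p] positive_conj[OF pos(4), of p]
    by (simp_all add: x_def y_def op_ring ap pp)
  moreover have "positive z" "positive t"
    using positive_conj[OF pos(1), of q] positive_conj[OF pos(2), of q]
    by (simp_all add: z_def t_def aq)
  ultimately have u: "positive u" unfolding u_def by (intro positive_add)
  have abs1: "op_abs (a - b) = u"
  proof (rule op_abs_eqI[OF u])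
    \<comment> \<open>The diagonal uses \<open>(y - x)\<^sup>2 + 4 x y = (x + y)\<^sup>2\<close> and
      its analogue for \<open>z\<close>, \<open>t\<close>; the off-diagonal terms cancel by
      intertwining.\<close>
    show "u \<cdot> u = adj (a - b) \<cdot> (a - b)"
      unfolding adj_diff sa by (simp add: a_eq b_eq u_def op_ring rels algebra_simps)
  qed
  define w where "w = id_blinfun - u"
  have aw: "adj w = w" by (simp add: w_def positive_adj[OF u])
  text \<open>On the diagonal blocks \<open>a - a\<^sup>2\<close> is \<open>x (1 - x - y)\<close> and \<open>z (1 - z - t)\<close>, and likewise for
    \<open>b\<close>; these sum to \<open>u (1 - u) = w - w\<^sup>2\<close>, which forces \<open>w \<ge> 0\<close>.\<close>
  have ww: "w - w \<cdot> w = adj p \<cdot> (a - a \<cdot> a) \<cdot> p + adj q \<cdot> (a - a \<cdot> a) \<cdot> q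
      + (adj p \<cdot> (b - b \<cdot> b) \<cdot> p + adj q \<cdot> (b - b \<cdot> b) \<cdot> q)"
    unfolding ap aq by (simp add: a_eq b_eq w_def u_def q op_ring rels algebra_simps)
  have "positive (w - w \<cdot> w)"
    unfolding ww by (intro positive_add positive_conj unit_interval_diff_square_positive a01 b01)
  moreover have "positive (w \<cdot> w)" using positive_adj_compose[of w] by (simp add: aw)
  ultimately have "positive ((w - w \<cdot> w) + w \<cdot> w)" by (rule positive_add)
  then have w: "positive w" by simp
  have "op_abs (id_blinfun - a - b) = w"
  proof (rule op_abs_eqI[OF w])
    \<comment> \<open>The off-diagonal blocks of \<open>a\<close> and \<open>b\<close> cancel, so
      \<open>id_blinfun - a - b\<close> is block diagonal and differs from \<open>w\<close> only by
      the sign on the block of \<open>p\<close>.\<close>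
    show "w \<cdot> w = adj (id_blinfun - a - b) \<cdot> (id_blinfun - a - b)"
      unfolding adj_diff sa adj_id by (simp add: a_eq b_eq w_def u_def op_ring rels algebra_simps)
  qed
  then show ?thesis by (simp add: absolutely_compatible_def abs1 w_def)
qed

theorem theorem2p2:
  fixes J :: "'h::{real_inner,complete_space} \<Rightarrow>\<^sub>L 'h"
    and M :: "('h \<Rightarrow>\<^sub>L 'h) set"
    and a b :: "'h \<Rightarrow>\<^sub>L 'h"
  assumes vN: "von_neumann_algebra J M"
    and aM: "a \<in> M" and bM: "b \<in> M"
    and a01: "unit_interval_op a" and b01: "unit_interval_op b"
  shows "absolutely_compatible a b \<longleftrightarrow>
    (\<exists>p1\<in>M. is_projection p1 \<and>
      (let p2 = id_blinfun - p1;
           a11 = p1 o\<^sub>L a o\<^sub>L p1; a12 = p1 o\<^sub>L a o\<^sub>L p2; a22 = p2 o\<^sub>L a o\<^sub>L p2;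
           b11 = p1 o\<^sub>L b o\<^sub>L p1; b12 = p1 o\<^sub>L b o\<^sub>L p2; b22 = p2 o\<^sub>L b o\<^sub>L p2
       in is_range_projection M (jordan a b) p1
        \<and> a12 + b12 = 0
        \<and> op_abs (adj a12) o\<^sub>L op_abs (adj a12) = (p1 - a11) o\<^sub>L (p1 - b11)
        \<and> op_abs a12 o\<^sub>L op_abs a12 = a22 o\<^sub>L b22
        \<and> a22 o\<^sub>L b22 = b22 o\<^sub>L a22
        \<and> a12 = (a11 o\<^sub>L a12) + (a12 o\<^sub>L a22)
        \<and> a12 = (b11 o\<^sub>L a12) + (a12 o\<^sub>L b22)))"
proof -
  have sa: "adj a = a" "adj b = b"
    using a01 b01 by (auto simp: unit_interval_op_def positive_adj)
  \<comment> \<open>Squared absolute values become products of off-diagonal blocks, the form used by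
    both block lemmas.\<close>
  have square12: "op_abs (p \<cdot> a \<cdot> q) \<cdot> op_abs (p \<cdot> a \<cdot> q) = (q \<cdot> a \<cdot> p) \<cdot> (p \<cdot> a \<cdot> q)"
    and square21: "op_abs (adj (p \<cdot> a \<cdot> q)) \<cdot> op_abs (adj (p \<cdot> a \<cdot> q))
      = (p \<cdot> a \<cdot> q) \<cdot> (q \<cdot> a \<cdot> p)"
    if "is_projection p" "q = id_blinfun - p" for p q
    using that by (simp_all only: op_abs_square)
      (simp_all add: is_projection_def sa blinfun_compose_assoc)
  show ?thesis
    unfolding Let_def
  proof (intro iffI, goal_cases)
    case 1
    have e: "adj (jordan a b) = jordan a b" by (simp add: jordan_def sa add.commute)
    obtain p where p: "is_range_projection M (jordan a b) p"
      and ann: "\<And>T::'h op. T \<cdot> jordan a b = 0 \<Longrightarrow> T \<cdot> p = 0"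
      and comm: "\<And>T. T \<cdot> jordan a b = jordan a b \<cdot> T \<Longrightarrow> T \<cdot> p = p \<cdot> T"
      using von_neumann_algebra_range_projection[OF vN jordan_mem[OF vN aM bM] e] by blast
    have pM: "p \<in> M" "is_projection p" and pp: "p \<cdot> p = p" and pe: "p \<cdot> jordan a b = jordan a b"
      using p by (auto simp: is_range_projection_def is_projection_def)
    obtain v h where vh: "p \<cdot> v = v \<cdot> p" "h \<cdot> v = v \<cdot> h" "h \<cdot> h = v \<cdot> v"
      "a = p + v - v \<cdot> p - v \<cdot> p + h" "b = p + v - v \<cdot> p - v \<cdot> p - h"
      using absolutely_compatible_range_projection[OF sa 1 pp pe ann comm] by metis
    show ?case
      unfolding Let_def
      by (intro bexI[OF _ pM(1)] conjI pM(2) p compatible_block_identities[OF pp vh refl]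
          square12[OF pM(2) refl, THEN trans] square21[OF pM(2) refl, THEN trans])
  next
    case 2
    then obtain p where p: "is_projection p"
      and blocks: "p \<cdot> a \<cdot> (id_blinfun - p) + p \<cdot> b \<cdot> (id_blinfun - p) = 0"
      "op_abs (adj (p \<cdot> a \<cdot> (id_blinfun - p))) \<cdot> op_abs (adj (p \<cdot> a \<cdot> (id_blinfun - p)))
        = (p - p \<cdot> a \<cdot> p) \<cdot> (p - p \<cdot> b \<cdot> p)"
      "op_abs (p \<cdot> a \<cdot> (id_blinfun - p)) \<cdot> op_abs (p \<cdot> a \<cdot> (id_blinfun - p))
        = ((id_blinfun - p) \<cdot> a \<cdot> (id_blinfun - p)) \<cdot> ((id_blinfun - p) \<cdot> b \<cdot> (id_blinfun - p))"
      "((id_blinfun - p) \<cdot> a \<cdot> (id_blinfun - p)) \<cdot> ((id_blinfun - p) \<cdot> b \<cdot> (id_blinfun - p))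
        = ((id_blinfun - p) \<cdot> b \<cdot> (id_blinfun - p)) \<cdot> ((id_blinfun - p) \<cdot> a \<cdot> (id_blinfun - p))"
      "p \<cdot> a \<cdot> (id_blinfun - p) = (p \<cdot> a \<cdot> p) \<cdot> (p \<cdot> a \<cdot> (id_blinfun - p))
        + (p \<cdot> a \<cdot> (id_blinfun - p)) \<cdot> ((id_blinfun - p) \<cdot> a \<cdot> (id_blinfun - p))"
      "p \<cdot> a \<cdot> (id_blinfun - p) = (p \<cdot> b \<cdot> p) \<cdot> (p \<cdot> a \<cdot> (id_blinfun - p))
        + (p \<cdot> a \<cdot> (id_blinfun - p)) \<cdot> ((id_blinfun - p) \<cdot> b \<cdot> (id_blinfun - p))"
      by (elim bexE conjE) (rule that; assumption)
    show ?case
      by (rule block_identities_compatible[OF a01 b01 p refl blocks(1)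
            blocks(2)[unfolded square21[OF p refl]] blocks(3)[unfolded square12[OF p refl]]
            blocks(4-6)])
  qed
qed

end
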